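(* Let $G=(V,E)$ be a finite undirected graph, $R\subseteq V$ a set of terminal nodes, $r\in R$ a chosen root, $K$ the set of commodities (one for each node of $R\setminus\{r\}$) and $b=|K|$. For every laminar family $l\in\mathcal{L}_b$, $$\mathrm{Conv}(\mathcal{Q}_l^{IP})=\mathcal{Q}_l^{LP},$$ where $\mathcal{Q}_l^{IP}$ and $\mathcal{Q}_l^{LP}$ are the feasible regions of the integer program $\mathcal{Z}_l$ and of its linear programming relaxation $LP(\mathcal{Z}_l)$, and $\mathrm{Conv}$ denotes the convex hull.
   Context: Setting. $G=(V,E)$ is a finite undirected graph and $R\subseteq V$ is a set of terminal nodes with $|R|\ge 2$. $D=(V,A)$ is the directed graph having, for every edge $\{i,j\}\in E$, the two arcs $(i,j)$ and $(j,i)$ in $A$. $\delta^+(i)$ and $\delta^-(i)$ are the sets of arcs of $D$ leaving and entering node $i$. A root $r\in R$ is fixed. $K$ is a set of commodities, one for each node of $R\setminus\{r\}$; commodity $k$ has source $r$ and sink $t_k$, where $t_k$ is its corresponding node in $R\setminus\{r\}$. Put $b=|K|$. Laminar families. A family of sets is laminar if any two members $A,B$ satisfy $A\subseteq B$, $B\subseteq A$ or $A\cap B=\emptyset$. $\mathcal{L}_b$ is the set of all laminar families $l$ of nonempty subsets of $K$ that contain $K$ and all singletons $\{k\}$, $k\in K$. For $l\in\mathcal{L}_b$, $S(l)$ is the set of subsets of $K$ belonging to $l$. For $s\in S(l)$ with $|s|\ge 2$, the child sets of $s$ are the inclusion-maximal members of $S(l)$ properly contained in $s$; they form a partition of $s$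 into at least two parts, denoted $P_l(s)$. $P(l)=\{P_l(s): s\in S(l),|s|\ge2\}$, and for $p\in P(l)$, $S_l(p)$ is the set of child sets that make up $p$. The program $\mathcal{Z}_l$. The variables are $f=(f_a^s)_{a\in A,s\in S(l)}$, $\hat y=(\hat y_i^s)_{i\in V,s\in S(l)}$, $\overline y=(\overline y_i^s)_{i\in V,s\in S(l)}$, $w=(w_i^p)_{i\in V,p\in P(l)}$. The objective is to minimize $\sum_{a\in A}c_a\sum_{s\in S(l)}f_a^s$ (with arc costs $c_a\ge 0$) subject to the linear constraints - $\sum_{a\in\delta^+(i)}f_a^s-\sum_{a\in\delta^-(i)}f_a^s=\hat y_i^s-\overline y_i^s$ for all $i\in V$, $s\in S(l)$; - $w_i^{p}=\overline y_i^s$ for all $i\in V$, $s\in S(l)$ with $|s|\ge 2$, and $p=P_l(s)$; - $w_i^p=\hat y_i^s$ for all $i\in V$, $p\in P(l)$, $s\in S_l(p)$; - $\sum_{i\in V}w_i^p=1$ for all $p\in P(l)$; - $\hat y_r^K=1$, and $\hat y_i^K=0$ for all $i\in V\setminus\{r\}$; - $\overline y_{t_k}^{\{k\}}=1$, and $\overline y_i^{\{k\}}=0$ for all $k\in K$, $i\in V\setminus\{t_k\}$; and the integrality constraints that all entries of $f,\hat y,\overline y,w$ lie in $\{0,1\}$. $LP(\mathcal{Z}_l)$ is obtained by replacing $\{0,1\}$ by $[0,1]$ for all variables. $\mathcal{Q}_l^{IP}$ and $\mathcal{Q}_l^{LP}$ are the sets of feasible $(f,w,\hat y,\overline y)$ of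 $\mathcal{Z}_l$ and $LP(\mathcal{Z}_l)$ respectively. *)

theory Defs
  imports "HOL-Analysis.Analysis"
begin

definition simple_graph :: "'v set \<Rightarrow> 'v set set \<Rightarrow> bool" where
  "simple_graph V E \<longleftrightarrow> finite V \<and> (\<forall>e\<in>E. e \<subseteq> V \<and> card e = 2)"

definition arcs :: "'v set set \<Rightarrow> ('v \<times> 'v) set" where
  "arcs E = {(i, j). {i, j} \<in> E}"

definition out_arcs :: "'v set set \<Rightarrow> 'v \<Rightarrow> ('v \<times> 'v) set" where
  "out_arcs E i = {a \<in> arcs E. fst a = i}"

definition in_arcs :: "'v set set \<Rightarrow> 'v \<Rightarrow> ('v \<times> 'v) set" where
  "in_arcs E i = {a \<in> arcs E. snd a = i}"

definition laminar :: "'k set set \<Rightarrow> bool" where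
  "laminar l \<longleftrightarrow> (\<forall>A\<in>l. \<forall>B\<in>l. A \<subseteq> B \<or> B \<subseteq> A \<or> A \<inter> B = {})"

definition laminar_families :: "'k set \<Rightarrow> 'k set set set" where
  "laminar_families K =
    {l. laminar l \<and> (\<forall>s\<in>l. s \<subseteq> K \<and> s \<noteq> {}) \<and> K \<in> l \<and> (\<forall>k\<in>K. {k} \<in> l)}"

definition child_sets :: "'k set set \<Rightarrow> 'k set \<Rightarrow> 'k set set" where
  "child_sets l s = {c \<in> l. c \<subset> s \<and> \<not> (\<exists>d\<in>l. c \<subset> d \<and> d \<subset> s)}"

text \<open>A partition is represented by the set of its parts, so the child sets making up
  \<open>p \<in> partitions l\<close> are simply the members of \<open>p\<close>.\<close>

definition partitions :: "'k set set \<Rightarrow> 'k set set set" where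
  "partitions l = {child_sets l s | s. s \<in> l \<and> card s \<ge> 2}"

text \<open>The points \<open>(f, w, yhat, ybar)\<close>. The families of variables are indexed by
  \<open>arcs E \<times> l\<close>, \<open>V \<times> partitions l\<close>, \<open>V \<times> l\<close> and \<open>V \<times> l\<close>; they are realised as vectors
  over the full index types whose coordinates outside these sets are fixed to 0.\<close>

type_synonym ('v, 'k) point =
  "(real ^ (('v \<times> 'v) \<times> 'k set)) \<times> (real ^ ('v \<times> 'k set set)) \<times>
   (real ^ ('v \<times> 'k set)) \<times> (real ^ ('v \<times> 'k set))"

definition supported_on :: "real ^ 'n \<Rightarrow> 'n set \<Rightarrow> bool" where
  "supported_on x I \<longleftrightarrow> (\<forall>n. n \<notin> I \<longrightarrow> x $ n = 0)"

definition is_point :: "'v::finite set \<Rightarrow> 'v set set \<Rightarrow> 'k::finite set set \<Rightarrow> ('v, 'k) point \<Rightarrow> bool" where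
  "is_point V E l = (\<lambda>(f, w, yhat, ybar).
     supported_on f (arcs E \<times> l) \<and> supported_on w (V \<times> partitions l) \<and>
     supported_on yhat (V \<times> l) \<and> supported_on ybar (V \<times> l))"

definition linear_constraints ::
  "'v::finite set \<Rightarrow> 'v set set \<Rightarrow> 'v \<Rightarrow> 'k::finite set \<Rightarrow> ('k \<Rightarrow> 'v) \<Rightarrow> 'k set set
    \<Rightarrow> ('v, 'k) point \<Rightarrow> bool" where
  "linear_constraints V E r K t l = (\<lambda>(f, w, yhat, ybar).
     (\<forall>i\<in>V. \<forall>s\<in>l. (\<Sum>a\<in>out_arcs E i. f $ (a, s)) - (\<Sum>a\<in>in_arcs E i. f $ (a, s))
        = yhat $ (i, s) - ybar $ (i, s)) \<and>
     (\<forall>i\<in>V. \<forall>s\<in>l. card s \<ge> 2 \<longrightarrow> w $ (i, child_sets l s) = ybar $ (i, s)) \<and>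
     (\<forall>i\<in>V. \<forall>p\<in>partitions l. \<forall>s\<in>p. w $ (i, p) = yhat $ (i, s)) \<and>
     (\<forall>p\<in>partitions l. (\<Sum>i\<in>V. w $ (i, p)) = 1) \<and>
     yhat $ (r, K) = 1 \<and> (\<forall>i\<in>V - {r}. yhat $ (i, K) = 0) \<and>
     (\<forall>k\<in>K. ybar $ (t k, {k}) = 1 \<and> (\<forall>i\<in>V - {t k}. ybar $ (i, {k}) = 0)))"

definition entries_in ::
  "real set \<Rightarrow> 'v::finite set \<Rightarrow> 'v set set \<Rightarrow> 'k::finite set set \<Rightarrow> ('v, 'k) point \<Rightarrow> bool" where
  "entries_in X V E l = (\<lambda>(f, w, yhat, ybar).
     (\<forall>a\<in>arcs E. \<forall>s\<in>l. f $ (a, s) \<in> X) \<and>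
     (\<forall>i\<in>V. \<forall>p\<in>partitions l. w $ (i, p) \<in> X) \<and>
     (\<forall>i\<in>V. \<forall>s\<in>l. yhat $ (i, s) \<in> X \<and> ybar $ (i, s) \<in> X))"

definition Q_IP ::
  "'v::finite set \<Rightarrow> 'v set set \<Rightarrow> 'v \<Rightarrow> 'k::finite set \<Rightarrow> ('k \<Rightarrow> 'v) \<Rightarrow> 'k set set
    \<Rightarrow> ('v, 'k) point set" where
  "Q_IP V E r K t l =
    {x. is_point V E l x \<and> linear_constraints V E r K t l x \<and> entries_in {0, 1} V E l x}"

definition Q_LP ::
  "'v::finite set \<Rightarrow> 'v set set \<Rightarrow> 'v \<Rightarrow> 'k::finite set \<Rightarrow> ('k \<Rightarrow> 'v) \<Rightarrow> 'k set set
    \<Rightarrow> ('v, 'k) point set" where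
  "Q_LP V E r K t l =
    {x. is_point V E l x \<and> linear_constraints V E r K t l x \<and> entries_in {0..1} V E l x}"

end

theory Submission imports Defs begin

text \<open>A feasible point sends one unit of flow through a tree of layers, one copy of the network
for each member \<open>s\<close> of the laminar family. In layer \<open>s\<close> the unit enters with distribution
\<open>yhat\<close> over the nodes and leaves with distribution \<open>ybar\<close>; the variables \<open>w\<close> force every
child of \<open>s\<close> to be entered exactly where \<open>s\<close> is left. So neighbouring layers interact only
through a probability distribution on nodes, and integral choices can be made one
layer at a time, from the root downwards: once a node of positive entry probability is
fixed for a layer, integral flow theory supplies a 0/1 flow from it to some node of positive
exit probability, and that node is a legal entry for all the children.

The choices can moreover be made so that every coordinate of the fractional point
that is already 0 or 1 is retained (\<open>Q_LP_rounding\<close>). This is enough for integrality. If \<open>x\<close> is an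
extreme point of the relaxation and \<open>y\<close> is its rounding, then all constraints are linear
equations and bounds, and \<open>y\<close> agrees with \<open>x\<close> wherever \<open>x\<close> attains a bound, so \<open>x\<close> can be pushed
slightly away from \<open>y\<close> without leaving the relaxation; extremality forces
\<open>x = y\<close>. As the relaxation is compact and convex, the Krein-Milman theorem
represents it as the convex hull of its extreme points, hence of integral points.

Inside one layer the rounding (\<open>flow_rounding\<close>) rests on a counting argument: when
all net outflows are integers, every node that meets a fractional arc meets at least two,
so there are at least as many fractional arcs as such nodes, and the conservation
equations at these nodes, one of which is redundant, have a nonzero solution
supported on fractional arcs. Moving along it makes another arc integral.\<close>

section \<open>Rounding a flow with integral net outflows\<close>

lemma underdetermined_system_has_nontrivial_solution:
  fixes M :: "'n \<Rightarrow> 'e \<Rightarrow> real"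
  assumes "finite N" "finite F" "card N < card F"
  shows "\<exists>d. (\<exists>a\<in>F. d a \<noteq> 0) \<and> (\<forall>v\<in>N. (\<Sum>a\<in>F. M v a * d a) = 0)"
  using assms
proof (induction N arbitrary: F M rule: finite_induct)
  case empty
  then have "F \<noteq> {}" by auto
  then show ?case by (intro exI[of _ "\<lambda>_. 1"]) auto
next
  case (insert v N)
  show ?case
  proof (cases "\<forall>a\<in>F. M v a = 0")
    case True
    then show ?thesis using insert.IH[of F M] insert.prems insert.hyps by auto
  next
    case False
    then obtain p where p: "p \<in> F" "M v p \<noteq> 0" by auto
    \<comment> \<open>Eliminate the unknown \<open>p\<close> by means of equation \<open>v\<close>.\<close>
    define M' where "M' u a = M u a - M u p * M v a / M v p" for u a
    have "card N < card (F - {p})" using insert p by (simp add: card_Diff_singleton)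
    then obtain d where d: "\<exists>a\<in>F - {p}. d a \<noteq> 0"
      "\<And>u. u \<in> N \<Longrightarrow> (\<Sum>a\<in>F - {p}. M' u a * d a) = 0"
      using insert.IH[of "F - {p}" M'] insert.prems by auto
    define S where "S u = (\<Sum>a\<in>F - {p}. M u a * d a)" for u
    define d' where "d' = d(p := - S v / M v p)"
    have total: "(\<Sum>a\<in>F. M u a * d' a) = S u - M u p * S v / M v p" for u
    proof -
      have "(\<Sum>a\<in>F. M u a * d' a) = M u p * d' p + (\<Sum>a\<in>F - {p}. M u a * d' a)"
        using insert.prems p by (simp add: sum.remove)
      also have "(\<Sum>a\<in>F - {p}. M u a * d' a) = S u"
        unfolding S_def by (rule sum.cong) (auto simp: d'_def)
      finally show ?thesis by (simp add: d'_def)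
    qed
    have "S u - M u p * S v / M v p = 0" if "u \<in> N" for u
    proof -
      have "(\<Sum>a\<in>F - {p}. M' u a * d a) = S u - M u p * S v / M v p"
        unfolding S_def M'_def
        by (simp add: algebra_simps sum_subtractf sum_distrib_left sum_divide_distrib)
      then show ?thesis using d(2)[OF that] by simp
    qed
    moreover have "S v - M v p * S v / M v p = 0" using p by simp
    moreover have "\<exists>a\<in>F. d' a \<noteq> 0" using d(1) by (auto simp: d'_def)
    ultimately show ?thesis using total by (intro exI[of _ d']) auto
  qed
qed

text \<open>The node-arc incidence matrix of a directed multigraph; a loop gives a zero column.\<close>

definition incidence :: "('e \<Rightarrow> 'n) \<Rightarrow> ('e \<Rightarrow> 'n) \<Rightarrow> 'n \<Rightarrow> 'e \<Rightarrow> real" where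
  "incidence tail head v a = of_bool (tail a = v) - of_bool (head a = v)"

definition net_outflow ::
  "'e set \<Rightarrow> ('e \<Rightarrow> 'n) \<Rightarrow> ('e \<Rightarrow> 'n) \<Rightarrow> ('e \<Rightarrow> real) \<Rightarrow> 'n \<Rightarrow> real" where
  "net_outflow A tail head f v = (\<Sum>a\<in>A. incidence tail head v a * f a)"

definition fractional_arcs :: "'e set \<Rightarrow> ('e \<Rightarrow> real) \<Rightarrow> 'e set" where
  "fractional_arcs A f = {a \<in> A. f a \<notin> {0, 1}}"

lemma net_outflow_eq:
  assumes "finite A"
  shows "net_outflow A tail head f v
    = (\<Sum>a\<in>{a \<in> A. tail a = v}. f a) - (\<Sum>a\<in>{a \<in> A. head a = v}. f a)"
proof -
  have "net_outflow A tail head f v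
    = (\<Sum>a\<in>A. (if tail a = v then f a else 0) - (if head a = v then f a else 0))"
    unfolding net_outflow_def incidence_def by (rule sum.cong) auto
  then show ?thesis using assms by (simp add: sum_subtractf sum.inter_filter)
qed

lemma sum_net_outflow_eq_0:
  assumes "finite A" "finite N" "tail ` A \<subseteq> N" "head ` A \<subseteq> N"
  shows "(\<Sum>v\<in>N. net_outflow A tail head f v) = 0"
  using assms
  by (simp add: net_outflow_eq sum_subtractf sum.group)

text \<open>If a single fractional arc met \<open>v\<close>, the remaining arcs would contribute an integer to the net
outflow, which could then not be an integer. A fractional loop counts twice, as it is both
an outgoing and an incoming arc.\<close>

lemma fractional_degree_ge_2:
  assumes "finite A" "\<And>a. a \<in> A \<Longrightarrow> f a \<in> {0..1}"
    and int: "net_outflow A tail head f v \<in> \<int>"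
    and F: "F = fractional_arcs A f" and v: "v \<in> tail ` F \<union> head ` F"
  shows "2 \<le> card {a \<in> F. tail a = v} + card {a \<in> F. head a = v}"
proof (rule ccontr)
  assume less: "\<not> ?thesis"
  have F': "finite F" "F \<subseteq> A" using assms by (auto simp: fractional_arcs_def)
  let ?T = "{a \<in> F. tail a = v}" and ?H = "{a \<in> F. head a = v}"
  have fin: "finite ?T" "finite ?H" using F' by auto
  have "net_outflow A tail head f v = net_outflow (A - F) tail head f v + net_outflow F tail head f v"
    unfolding net_outflow_def using F' assms(1) by (simp add: sum.subset_diff)
  moreover have "net_outflow (A - F) tail head f v \<in> \<int>"
    unfolding net_outflow_def incidence_def F fractional_arcs_def
    by (intro Ints_sum) (auto simp: of_bool_def)
  ultimately have *: "net_outflow F tail head f v \<in> \<int>"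
    using int by (metis Ints_diff add_diff_cancel_left')
  have nonint: "f a \<notin> \<int>" if "a \<in> F" for a
  proof
    assume "f a \<in> \<int>"
    then obtain k where k: "f a = of_int k" by (auto elim: Ints_cases)
    have "f a \<in> {0..1}" "f a \<notin> {0, 1}"
      using that assms(2) by (auto simp: F fractional_arcs_def)
    then have "0 < k" "k < 1" using k by (auto simp: less_le)
    then show False by simp
  qed
  have "?T \<noteq> {} \<or> ?H \<noteq> {}" using v by auto
  then have "card ?T > 0 \<or> card ?H > 0" using fin by (auto simp: card_gt_0_iff)
  then consider "card ?T = 1" "card ?H = 0" | "card ?T = 0" "card ?H = 1"
    using less by linarith
  then show False
  proof cases
    case 1
    then obtain a where "?T = {a}" "?H = {}" using fin by (auto simp only: card_1_singleton_iff card_0_eq One_nat_def)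
    note sets = this
    have "a \<in> F" using sets(1) by auto
    moreover have "net_outflow F tail head f v = f a"
      unfolding net_outflow_eq[OF F'(1)] sets by simp
    ultimately show False using nonint * by auto
  next
    case 2
    then obtain a where "?H = {a}" "?T = {}" using fin by (auto simp only: card_1_singleton_iff card_0_eq One_nat_def)
    note sets = this
    have "a \<in> F" using sets(1) by auto
    moreover have "net_outflow F tail head f v = - f a"
      unfolding net_outflow_eq[OF F'(1)] sets by simp
    ultimately show False using nonint * by auto
  qed
qed

text \<open>Let \<open>F\<close> be the set of fractional arcs and \<open>N\<close> the set of their endpoints. Summing degrees gives
\<open>2 * card N \<le> 2 * card F\<close>. Conservation at all nodes of \<open>N\<close> but one implies conservation at
the last one, since net outflows add up to zero; this leaves fewer equations than unknowns.\<close>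

lemma fractional_circulation_exists:
  assumes "finite A" "\<And>a. a \<in> A \<Longrightarrow> f a \<in> {0..1}"
    and int: "\<And>v. net_outflow A tail head f v \<in> \<int>"
    and ne: "fractional_arcs A f \<noteq> {}"
  obtains d where "\<exists>a\<in>fractional_arcs A f. d a \<noteq> 0"
    "\<And>a. a \<notin> fractional_arcs A f \<Longrightarrow> d a = 0"
    "\<And>v. net_outflow A tail head d v = 0"
proof -
  define F where "F = fractional_arcs A f"
  define N where "N = tail ` F \<union> head ` F"
  have F: "finite F" "F \<subseteq> A" "F \<noteq> {}" using assms by (auto simp: F_def fractional_arcs_def)
  have N: "finite N" using F by (auto simp: N_def)
  obtain v0 where v0: "v0 \<in> N" using F by (auto simp: N_def)
  have "2 * card N = (\<Sum>v\<in>N. 2)" by simp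
  also have "\<dots> \<le> (\<Sum>v\<in>N. card {a \<in> F. tail a = v} + card {a \<in> F. head a = v})"
    by (intro sum_mono fractional_degree_ge_2[OF assms(1,2) int F_def]) (auto simp: N_def)
  also have "\<dots> = (\<Sum>v\<in>N. \<Sum>a\<in>{a \<in> F. tail a = v}. 1) + (\<Sum>v\<in>N. \<Sum>a\<in>{a \<in> F. head a = v}. 1)"
    by (simp add: sum.distrib)
  also have "\<dots> = card F + card F"
    using F N by (subst (1 2) sum.group) (auto simp: N_def)
  finally have "card N \<le> card F" by simp
  then have "card (N - {v0}) < card F"
    using N v0 by (metis card_Diff1_less order_less_le_trans)
  then obtain d0 where d0: "\<exists>a\<in>F. d0 a \<noteq> 0"
    "\<And>v. v \<in> N - {v0} \<Longrightarrow> (\<Sum>a\<in>F. incidence tail head v a * d0 a) = 0"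
    using underdetermined_system_has_nontrivial_solution[of "N - {v0}" F "incidence tail head"]
      N F by auto
  define d where "d a = (if a \<in> F then d0 a else 0)" for a
  have restrict: "net_outflow A tail head d v = net_outflow F tail head d0 v" for v
    unfolding net_outflow_def using F assms(1)
    by (intro sum.mono_neutral_cong_right) (auto simp: d_def)
  have away: "net_outflow F tail head d0 v = 0" if "v \<noteq> v0" for v
  proof (cases "v \<in> N")
    case True
    then show ?thesis using d0(2) that by (simp add: net_outflow_def)
  next
    case False
    then show ?thesis unfolding net_outflow_def incidence_def N_def
      by (intro sum.neutral) auto
  qed
  \<comment> \<open>The equation dropped at \<open>v0\<close> follows from the others.\<close>
  have "0 = (\<Sum>v\<in>N. net_outflow F tail head d0 v)"
    using F N by (subst sum_net_outflow_eq_0) (auto simp: N_def)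
  also have "\<dots> = net_outflow F tail head d0 v0"
    using N v0 away by (simp add: sum.remove)
  finally have zero: "net_outflow A tail head d v = 0" for v
    using away restrict by metis
  have "\<exists>a\<in>fractional_arcs A f. d a \<noteq> 0" "\<And>a. a \<notin> fractional_arcs A f \<Longrightarrow> d a = 0"
    using d0(1) by (auto simp: d_def F_def)
  then show ?thesis using that zero by blast
qed

lemma maximal_step_in_unit_cube:
  fixes f d :: "'e \<Rightarrow> real"
  assumes "finite F" "\<And>a. a \<in> F \<Longrightarrow> 0 < f a \<and> f a < 1" "\<exists>a\<in>F. d a \<noteq> 0"
  obtains \<tau> where "\<tau> > 0" "\<And>a. a \<in> F \<Longrightarrow> f a + \<tau> * d a \<in> {0..1}"
    "\<exists>a\<in>F. f a + \<tau> * d a \<in> {0, 1}"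
proof -
  \<comment> \<open>\<open>room a\<close> is the step length at which coordinate \<open>a\<close> reaches a bound.\<close>
  define room where "room a = (if d a > 0 then (1 - f a) / d a else f a / (- d a))" for a
  define D where "D = {a \<in> F. d a \<noteq> 0}"
  define \<tau> where "\<tau> = Min (room ` D)"
  have D: "finite (room ` D)" "room ` D \<noteq> {}" using assms by (auto simp: D_def)
  have pos: "room a > 0" if "a \<in> D" for a
    using that assms(2)[of a] by (auto simp: room_def D_def divide_pos_neg)
  have le: "\<tau> \<le> room a" if "a \<in> D" for a using that D by (auto simp: \<tau>_def)
  have "\<tau> \<in> room ` D" unfolding \<tau>_def by (rule Min_in[OF D])
  then obtain b where b: "b \<in> D" "\<tau> = room b" by auto
  have "\<tau> > 0" using pos b by auto
  moreover have "f a + \<tau> * d a \<in> {0..1}" if "a \<in> F" for a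
  proof (cases "d a" "0 :: real" rule: linorder_cases)
    case less
    then have "\<tau> \<le> f a / (- d a)" using le[of a] that by (auto simp: D_def room_def)
    then have "\<tau> * (- d a) \<le> f a" using less by (subst (asm) pos_le_divide_eq) auto
    moreover have "\<tau> * d a \<le> 0" using less \<open>\<tau> > 0\<close> by (simp add: mult_pos_neg less_imp_le)
    ultimately show ?thesis using assms(2)[OF that] by auto
  next
    case equal
    then show ?thesis using assms(2)[OF that] by auto
  next
    case greater
    then have "\<tau> \<le> (1 - f a) / d a" using le[of a] that by (auto simp: D_def room_def)
    then have "\<tau> * d a \<le> 1 - f a" using greater by (simp add: pos_le_divide_eq)
    moreover have "\<tau> * d a \<ge> 0" using greater \<open>\<tau> > 0\<close> by simp
    ultimately show ?thesis using assms(2)[OF that] by auto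
  qed
  moreover have "b \<in> F" "f b + \<tau> * d b \<in> {0, 1}"
    using b by (auto simp: D_def room_def)
  ultimately show ?thesis using that by blast
qed

text \<open>Induction on the number of fractional arcs: follow a circulation on these arcs until one of
them reaches 0 or 1. Since the circulation may be negated, the flow on the distinguished arc
\<open>a0\<close> can be kept from decreasing, so it stays positive and ends up as 1.\<close>

lemma flow_rounding:
  fixes f :: "'e \<Rightarrow> real"
  assumes "finite A" "\<And>a. a \<in> A \<Longrightarrow> f a \<in> {0..1}"
    and "\<And>v. net_outflow A tail head f v \<in> \<int>"
    and "a0 \<in> A" "f a0 > 0"
  shows "\<exists>g. (\<forall>a\<in>A. g a \<in> {0, 1}) \<and> (\<forall>a\<in>A. f a \<in> {0, 1} \<longrightarrow> g a = f a) \<and>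
    (\<forall>v. net_outflow A tail head g v = net_outflow A tail head f v) \<and> g a0 = 1"
  using assms
proof (induction "card (fractional_arcs A f)" arbitrary: f rule: less_induct)
  case less
  show ?case
  proof (cases "fractional_arcs A f = {}")
    case True
    then have "\<forall>a\<in>A. f a \<in> {0, 1}" by (auto simp: fractional_arcs_def)
    then show ?thesis using less.prems by (intro exI[of _ f]) auto
  next
    case False
    let ?F = "fractional_arcs A f"
    obtain d0 where d0: "\<exists>a\<in>?F. d0 a \<noteq> 0" "\<And>a. a \<notin> ?F \<Longrightarrow> d0 a = 0"
      "\<And>v. net_outflow A tail head d0 v = 0"
      using fractional_circulation_exists[OF less.prems(1-3) False] by metis
    \<comment> \<open>The sign is chosen so that the flow on \<open>a0\<close> does not decrease.\<close>
    define \<sigma> :: real where "\<sigma> = (if d0 a0 < 0 then -1 else 1)"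
    define d where "d a = \<sigma> * d0 a" for a
    have d: "\<exists>a\<in>?F. d a \<noteq> 0" "\<And>a. a \<notin> ?F \<Longrightarrow> d a = 0" "d a0 \<ge> 0"
      using d0 by (auto simp: d_def \<sigma>_def)
    have circ: "net_outflow A tail head d v = 0" for v
    proof -
      have "net_outflow A tail head d v = \<sigma> * net_outflow A tail head d0 v"
        by (simp add: net_outflow_def d_def sum_distrib_left algebra_simps)
      then show ?thesis by (simp add: d0)
    qed
    have fin: "finite ?F" using less.prems by (auto simp: fractional_arcs_def)
    have open01: "0 < f a \<and> f a < 1" if "a \<in> ?F" for a
      using that less.prems(2)[of a] by (auto simp: fractional_arcs_def)
    obtain \<tau> where \<tau>: "\<tau> > 0" "\<And>a. a \<in> ?F \<Longrightarrow> f a + \<tau> * d a \<in> {0..1}"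
      "\<exists>a\<in>?F. f a + \<tau> * d a \<in> {0, 1}"
      using maximal_step_in_unit_cube[of ?F f d] fin open01 d(1) by metis
    define f' where "f' a = f a + \<tau> * d a" for a
    have same: "f' a = f a" if "a \<notin> ?F" for a using d(2)[OF that] by (simp add: f'_def)
    have outflow: "net_outflow A tail head f' v = net_outflow A tail head f v" for v
    proof -
      have "net_outflow A tail head f' v
        = net_outflow A tail head f v + \<tau> * net_outflow A tail head d v"
        by (simp add: net_outflow_def f'_def sum_distrib_left sum.distrib algebra_simps)
      then show ?thesis by (simp add: circ)
    qed
    have "fractional_arcs A f' \<subseteq> ?F"
      using same by (auto simp: fractional_arcs_def)
    moreover have "fractional_arcs A f' \<noteq> ?F"
      using \<tau>(3) by (auto simp: fractional_arcs_def f'_def)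
    ultimately have "card (fractional_arcs A f') < card ?F"
      using fin by (intro psubset_card_mono) auto
    moreover have "f' a \<in> {0..1}" if "a \<in> A" for a
      using \<tau>(2)[of a] same[of a] less.prems(2)[OF that] by (cases "a \<in> ?F") (auto simp: f'_def)
    moreover have "f' a0 > 0" using less.prems(5) d(3) \<tau>(1) by (simp add: f'_def add_pos_nonneg)
    ultimately obtain g where g: "\<forall>a\<in>A. g a \<in> {0, 1}" "\<forall>a\<in>A. f' a \<in> {0, 1} \<longrightarrow> g a = f' a"
      "\<forall>v. net_outflow A tail head g v = net_outflow A tail head f' v" "g a0 = 1"
      using less.hyps[of f'] less.prems outflow by metis
    have "\<forall>a\<in>A. f a \<in> {0, 1} \<longrightarrow> g a = f a"
      using g(2) same by (auto simp: fractional_arcs_def)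
    then show ?thesis using g outflow by auto
  qed
qed

section \<open>Rounding within one layer\<close>

text \<open>The network of one layer is extended by a source and a sink, so that the entry and exit
distributions become flows on arcs, to which integral rounding applies. The extra
nodes have net outflow \<open>1\<close> and \<open>-1\<close>, all others \<open>0\<close>.\<close>

datatype 'v layer_node = Source | Sink | Node 'v
datatype 'v layer_arc = Inner "'v \<times> 'v" | Enter 'v | Exit 'v

fun layer_tail :: "'v layer_arc \<Rightarrow> 'v layer_node" where
  "layer_tail (Inner a) = Node (fst a)"
| "layer_tail (Enter v) = Source"
| "layer_tail (Exit v) = Node v"

fun layer_head :: "'v layer_arc \<Rightarrow> 'v layer_node" where
  "layer_head (Inner a) = Node (snd a)"
| "layer_head (Enter v) = Node v"
| "layer_head (Exit v) = Sink"

definition layer_arcs :: "'v set \<Rightarrow> ('v \<times> 'v) set \<Rightarrow> 'v layer_arc set" where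
  "layer_arcs V A = Inner ` A \<union> Enter ` V \<union> Exit ` V"

abbreviation layer_outflow ::
  "'v set \<Rightarrow> ('v \<times> 'v) set \<Rightarrow> ('v layer_arc \<Rightarrow> real) \<Rightarrow> 'v layer_node \<Rightarrow> real" where
  "layer_outflow V A \<equiv> net_outflow (layer_arcs V A) layer_tail layer_head"

lemma layer_outflow_split:
  assumes "finite V" "finite A"
  shows "layer_outflow V A h n =
    (\<Sum>a\<in>A. incidence layer_tail layer_head n (Inner a) * h (Inner a)) +
    (\<Sum>v\<in>V. incidence layer_tail layer_head n (Enter v) * h (Enter v)) +
    (\<Sum>v\<in>V. incidence layer_tail layer_head n (Exit v) * h (Exit v))"
  unfolding net_outflow_def layer_arcs_def using assms
  by (subst sum.union_disjoint, auto)+ (simp add: sum.reindex inj_on_def)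

lemma layer_outflow_simps:
  assumes "finite V" "A \<subseteq> V \<times> V"
  shows "layer_outflow V A h Source = (\<Sum>v\<in>V. h (Enter v))"
    and "layer_outflow V A h Sink = - (\<Sum>v\<in>V. h (Exit v))"
    and "v \<in> V \<Longrightarrow> layer_outflow V A h (Node v) =
      net_outflow A fst snd (\<lambda>a. h (Inner a)) v - h (Enter v) + h (Exit v)"
    and "v \<notin> V \<Longrightarrow> layer_outflow V A h (Node v) = 0"
proof -
  have A: "finite A" using assms by (meson finite_SigmaI finite_subset)
  note split = layer_outflow_split[OF assms(1) A]
  show "layer_outflow V A h Source = (\<Sum>v\<in>V. h (Enter v))"
    "layer_outflow V A h Sink = - (\<Sum>v\<in>V. h (Exit v))"
    by (simp_all add: split incidence_def sum_negf)
  have inner: "(\<Sum>a\<in>A. incidence layer_tail layer_head (Node v) (Inner a) * h (Inner a))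
      = net_outflow A fst snd (\<lambda>a. h (Inner a)) v" for v
    by (simp add: net_outflow_def incidence_def)
  show "layer_outflow V A h (Node v) =
      net_outflow A fst snd (\<lambda>a. h (Inner a)) v - h (Enter v) + h (Exit v)" if "v \<in> V"
    unfolding split inner using that assms(1)
    by (simp add: incidence_def sum_negf if_distrib[of "\<lambda>x. x * _"] of_bool_def cong: if_cong)
  show "layer_outflow V A h (Node v) = 0" if "v \<notin> V"
  proof -
    have "net_outflow A fst snd (\<lambda>a. h (Inner a)) v = 0"
      unfolding net_outflow_def using that assms(2)
      by (intro sum.neutral) (auto simp: incidence_def)
    moreover have "(\<Sum>u\<in>V. incidence layer_tail layer_head (Node v) (Enter u) * h (Enter u)) = 0"
      "(\<Sum>u\<in>V. incidence layer_tail layer_head (Node v) (Exit u) * h (Exit u)) = 0"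
      using that by (auto simp: incidence_def intro!: sum.neutral)
    ultimately show ?thesis unfolding split inner by simp
  qed
qed

text \<open>The value 1 at a node other than \<open>j\<close> would make the total mass exceed 1.\<close>

lemma unit_sum_01_eq_indicator:
  fixes z :: "'v \<Rightarrow> real"
  assumes "finite V" "\<And>v. v \<in> V \<Longrightarrow> 0 \<le> z v" "sum z V = 1" "j \<in> V" "z j > 0"
    and "v \<in> V" "z v \<in> {0, 1}"
  shows "z v = of_bool (v = j)"
proof (cases "v = j")
  case True
  then show ?thesis using assms by auto
next
  case False
  have "z j + z v = sum z {j, v}" using False by simp
  also have "\<dots> \<le> sum z V" using assms by (intro sum_mono2) auto
  finally show ?thesis using assms False by auto
qed

text \<open>Rounding the extended flow while keeping the arc \<open>Enter i\<close> positive makes \<open>i\<close> the only entry,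
since the source still emits one unit. In the same way there is exactly one exit \<open>j\<close>, and
\<open>z j > 0\<close> because arcs of value 0 keep that value.\<close>

lemma layer_rounding:
  fixes f :: "'v \<times> 'v \<Rightarrow> real" and x z :: "'v \<Rightarrow> real"
  assumes V: "finite V" and A: "A \<subseteq> V \<times> V"
    and f: "\<And>a. a \<in> A \<Longrightarrow> f a \<in> {0..1}"
    and x: "\<And>v. v \<in> V \<Longrightarrow> x v \<in> {0..1}" "sum x V = 1"
    and z: "\<And>v. v \<in> V \<Longrightarrow> z v \<in> {0..1}" "sum z V = 1"
    and flow: "\<And>v. v \<in> V \<Longrightarrow> net_outflow A fst snd f v = x v - z v"
    and i: "i \<in> V" "x i > 0"
  shows "\<exists>j g. j \<in> V \<and> z j > 0 \<and> (\<forall>a\<in>A. g a \<in> {0, 1}) \<and>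
    (\<forall>a\<in>A. f a \<in> {0, 1} \<longrightarrow> g a = f a) \<and>
    (\<forall>v\<in>V. net_outflow A fst snd g v = of_bool (v = i) - of_bool (v = j))"
proof -
  define h where "h = case_layer_arc f x z"
  note outflow = layer_outflow_simps[OF V A]
  have h: "(\<lambda>a. h (Inner a)) = f" "h (Enter v) = x v" "h (Exit v) = z v" for v
    by (auto simp: h_def)
  have fin: "finite (layer_arcs V A)"
    using V finite_subset[OF A] by (auto simp: layer_arcs_def)
  have zero: "layer_outflow V A h (Node v) = 0" for v
    using outflow(3,4)[of v h] flow[of v] by (cases "v \<in> V") (auto simp: h)
  have int: "layer_outflow V A h n \<in> \<int>" for n
    using outflow(1,2)[of h] zero x z by (cases n) (auto simp: h)
  have unit: "h a \<in> {0..1}" if "a \<in> layer_arcs V A" for a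
    using that f x z by (auto simp: layer_arcs_def h_def)
  have enter_i: "Enter i \<in> layer_arcs V A" "h (Enter i) > 0"
    using i by (auto simp: layer_arcs_def h)
  obtain g where g: "\<forall>a\<in>layer_arcs V A. g a \<in> {0, 1}"
    "\<forall>a\<in>layer_arcs V A. h a \<in> {0, 1} \<longrightarrow> g a = h a"
    "\<forall>n. layer_outflow V A g n = layer_outflow V A h n" "g (Enter i) = 1"
    using flow_rounding[OF fin unit int enter_i] by blast
  note g_outflow = g(3)[rule_format]
  have in01: "g (Inner a) \<in> {0, 1}" if "a \<in> A" for a using that g(1) by (auto simp: layer_arcs_def)
  have en01: "g (Enter v) \<in> {0, 1}" if "v \<in> V" for v using that g(1) by (auto simp: layer_arcs_def)
  have ex01: "g (Exit v) \<in> {0, 1}" if "v \<in> V" for v using that g(1) by (auto simp: layer_arcs_def)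
  have sums: "(\<Sum>v\<in>V. g (Enter v)) = 1" "(\<Sum>v\<in>V. g (Exit v)) = 1"
    using g_outflow[of Source] g_outflow[of Sink] x z unfolding outflow h by auto
  have enter: "g (Enter v) = of_bool (v = i)" if "v \<in> V" for v
    using unit_sum_01_eq_indicator[OF V, of "\<lambda>v. g (Enter v)" i v] sums en01 i g(4) that
    by fastforce
  obtain j where j: "j \<in> V" "g (Exit j) \<noteq> 0"
    using sums(2) by (metis sum.neutral zero_neq_one)
  have exit: "g (Exit v) = of_bool (v = j)" if "v \<in> V" for v
    using unit_sum_01_eq_indicator[OF V, of "\<lambda>v. g (Exit v)" j v] sums ex01 j that
    by fastforce
  have "z j \<noteq> 0" using g(2) j h by (auto simp: layer_arcs_def)
  then have "z j > 0" using z(1) j by fastforce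
  moreover have "g (Inner a) = f a" if "a \<in> A" "f a \<in> {0, 1}" for a
    using g(2) that h(1) by (auto simp: layer_arcs_def h_def)
  moreover have "net_outflow A fst snd (\<lambda>a. g (Inner a)) v = of_bool (v = i) - of_bool (v = j)"
    if "v \<in> V" for v
    using g_outflow[of "Node v"] zero[of v] outflow(3)[OF that, of g] enter[OF that] exit[OF that]
    by simp
  ultimately show ?thesis using j in01 by (intro exI[of _ j] exI[of _ "\<lambda>a. g (Inner a)"]) auto
qed

section \<open>The tree structure of a laminar family\<close>

lemma child_setsD:
  assumes "c \<in> child_sets l s"
  shows "c \<in> l" "c \<subset> s"
  using assms by (auto simp: child_sets_def)

text \<open>Two sets with the common child \<open>c\<close> meet, hence are comparable by laminarity, and strict inclusion would place one strictly between \<open>c\<close> and the other.\<close>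

lemma parent_unique:
  fixes l :: "'k::finite set set"
  assumes "l \<in> laminar_families K" "s \<in> l" "s' \<in> l"
    and "c \<in> child_sets l s" "c \<in> child_sets l s'"
  shows "s = s'"
proof -
  have "c \<noteq> {}" "c \<subseteq> s" "c \<subseteq> s'"
    using assms by (auto simp: laminar_families_def child_sets_def)
  then have "s \<inter> s' \<noteq> {}" by auto
  then have "s \<subseteq> s' \<or> s' \<subseteq> s"
    using assms by (auto simp: laminar_families_def laminar_def)
  then show ?thesis
    using assms by (auto simp: child_sets_def)
qed

lemma parent_exists:
  fixes l :: "'k::finite set set"
  assumes "l \<in> laminar_families K" "c \<in> l" "c \<noteq> K"
  obtains s where "s \<in> l" "c \<in> child_sets l s"
proof -
  let ?X = "{s \<in> l. c \<subset> s}"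
  have "K \<in> ?X" using assms by (auto simp: laminar_families_def)
  then obtain s where s: "s \<in> ?X" "\<And>d. d \<in> ?X \<Longrightarrow> d \<subseteq> s \<Longrightarrow> s = d"
    using finite_has_minimal2[of ?X K] by (metis (no_types, lifting) finite)
  then have "c \<in> child_sets l s" using assms(2) by (fastforce simp: child_sets_def)
  then show ?thesis using that s by auto
qed

lemma two_le_card_parent:
  fixes l :: "'k::finite set set"
  assumes "l \<in> laminar_families K" "c \<in> child_sets l s"
  shows "2 \<le> card s"
proof -
  have "c \<noteq> {}" using assms by (auto simp: laminar_families_def child_sets_def)
  then have "card c > 0" by (simp add: card_gt_0_iff)
  moreover have "card c < card s" using child_setsD(2)[OF assms(2)] by (simp add: psubset_card_mono)
  ultimately show ?thesis by simp
qed

text \<open>Hence the partition \<open>child_sets l s\<close> determines \<open>s\<close>. Each \<open>k\<close> in \<open>s\<close> lies in a child of \<open>s\<close> because the singleton \<open>{k}\<close> belongs to the family.\<close>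

lemma Union_child_sets:
  fixes l :: "'k::finite set set"
  assumes "l \<in> laminar_families K" "s \<in> l" "2 \<le> card s"
  shows "\<Union>(child_sets l s) = s"
proof
  show "\<Union>(child_sets l s) \<subseteq> s" by (auto simp: child_sets_def)
  show "s \<subseteq> \<Union>(child_sets l s)"
  proof
    fix k assume k: "k \<in> s"
    let ?X = "{c \<in> l. k \<in> c \<and> c \<subset> s}"
    have "{k} \<in> l" "{k} \<noteq> s" using assms k by (auto simp: laminar_families_def)
    then have "{k} \<in> ?X" using k by auto
    then obtain c where c: "c \<in> ?X" "\<And>d. d \<in> ?X \<Longrightarrow> c \<subseteq> d \<Longrightarrow> c = d"
      using finite_has_maximal2[of ?X "{k}"] by (metis (no_types, lifting) finite)
    then have "c \<in> child_sets l s" unfolding child_sets_def by blast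
    then show "k \<in> \<Union>(child_sets l s)" using c by auto
  qed
qed

lemma card_le_1_member_laminar:
  fixes l :: "'k::finite set set"
  assumes "l \<in> laminar_families K" "s \<in> l" "\<not> 2 \<le> card s"
  obtains k where "k \<in> K" "s = {k}"
proof -
  have "s \<noteq> {}" "s \<subseteq> K" using assms by (auto simp: laminar_families_def)
  then have "card s > 0" by (simp add: card_gt_0_iff)
  then have "card s = 1" using assms(3) by simp
  then show ?thesis using that \<open>s \<subseteq> K\<close> by (auto simp: card_1_singleton_iff)
qed

text \<open>The graph of the function obtained by propagating a value down the tree: \<open>K\<close> receives \<open>r\<close>, and a
set \<open>s\<close> with value \<open>i\<close> passes the value \<open>J s i\<close> to its children.\<close>

inductive reached ::
  "'k set set \<Rightarrow> 'k set \<Rightarrow> ('k set \<Rightarrow> 'v \<Rightarrow> 'v) \<Rightarrow> 'v \<Rightarrow> 'k set \<Rightarrow> 'v \<Rightarrow> bool"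
  for l K J r where
  root: "reached l K J r K r"
| child: "reached l K J r s i \<Longrightarrow> s \<in> l \<Longrightarrow> c \<in> child_sets l s \<Longrightarrow> reached l K J r c (J s i)"

lemma reached_exists:
  fixes l :: "'k::finite set set"
  assumes "l \<in> laminar_families K" "s \<in> l"
  shows "\<exists>i. reached l K J r s i"
  using assms(2)
proof (induction "card K - card s" arbitrary: s rule: less_induct)
  case less
  show ?case
  proof (cases "s = K")
    case True
    then show ?thesis using reached.root by metis
  next
    case False
    then obtain u where u: "u \<in> l" "s \<in> child_sets l u"
      using parent_exists[OF assms(1) less.prems] by metis
    have "u \<subseteq> K" using u assms(1) by (auto simp: laminar_families_def)
    then have "card s < card u" "card u \<le> card K"
      using child_setsD(2)[OF u(2)] by (auto intro: psubset_card_mono card_mono)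
    then obtain i where "reached l K J r u i" using less.hyps[of u] u by fastforce
    then show ?thesis using reached.child u by metis
  qed
qed

lemma reached_unique:
  fixes l :: "'k::finite set set"
  assumes l: "l \<in> laminar_families K"
    and "reached l K J r s i" "reached l K J r s j"
  shows "i = j"
  using assms(2,3)
proof (induction arbitrary: j rule: reached.induct)
  case root
  have "K \<notin> child_sets l s" if "s \<in> l" for s
    using that l by (auto simp: child_sets_def laminar_families_def)
  then show ?case using root by (auto elim: reached.cases)
next
  case (child s i c)
  have "c \<noteq> K" using child.hyps l by (auto simp: child_sets_def laminar_families_def)
  then obtain s' i' where s': "reached l K J r s' i'" "s' \<in> l" "c \<in> child_sets l s'" "j = J s' i'"
    by (cases rule: reached.cases[OF child.prems]) auto
  then have "s' = s" using parent_unique[OF l] child.hyps by metis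
  then show ?case using child.IH s' by auto
qed

text \<open>Dependent choice along the tree: if every admissible entry \<open>i\<close> of \<open>s\<close> (that is, \<open>P s i\<close>) allows
an exit \<open>j\<close>, with further data \<open>y\<close>, that is an admissible entry of all children, then entries
and exits can be chosen simultaneously for all sets, each child being entered where its parent
is left. The existence of parents makes the propagated values defined everywhere, their
uniqueness makes them consistent.\<close>

lemma top_down_choice:
  fixes l :: "'k::finite set set"
  assumes l: "l \<in> laminar_families K" and root: "P K r"
    and step: "\<And>s i. s \<in> l \<Longrightarrow> P s i \<Longrightarrow>
      \<exists>j y. Q s i j y \<and> (\<forall>c\<in>child_sets l s. P c j)"
  shows "\<exists>en ex y. en K = r \<and> (\<forall>s\<in>l. P s (en s) \<and> Q s (en s) (ex s) (y s) \<and>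
    (\<forall>c\<in>child_sets l s. en c = ex s))"
proof -
  obtain J Y where JY: "\<And>s i. s \<in> l \<Longrightarrow> P s i \<Longrightarrow>
      Q s i (J s i) (Y s i) \<and> (\<forall>c\<in>child_sets l s. P c (J s i))"
    using step by metis
  define en where "en s = (THE i. reached l K J r s i)" for s
  have en: "en s = i" if "reached l K J r s i" for s i
    unfolding en_def by (rule the_equality, rule that, rule reached_unique[OF l _ that])
  have reached_en: "reached l K J r s (en s)" if s: "s \<in> l" for s
  proof -
    obtain i where "reached l K J r s i" using reached_exists[OF l s, of J r] by blast
    then show ?thesis using en by simp
  qed
  have P: "P s i" if "reached l K J r s i" for s i
    using that by induction (use root JY in blast)+
  have P_en: "P s (en s)" if "s \<in> l" for s using P reached_en[OF that] .
  have "en K = r" by (rule en[OF reached.root])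
  moreover have "Q s (en s) (J s (en s)) (Y s (en s))" if "s \<in> l" for s
    using JY[OF that P_en[OF that]] by blast
  moreover have "en c = J s (en s)" if "s \<in> l" "c \<in> child_sets l s" for s c
    by (rule en) (rule reached.child[OF reached_en[OF that(1)] that])
  ultimately show ?thesis using P_en
    by (intro exI[of _ en] exI[of _ "\<lambda>s. J s (en s)"] exI[of _ "\<lambda>s. Y s (en s)"]) blast
qed

section \<open>Integral points as routes through the layers\<close>

text \<open>The 0/1 point in which layer \<open>s\<close> is entered at \<open>en s\<close>, left at \<open>ex s\<close> and carries the flow \<open>g s\<close>.
The set that a partition \<open>p\<close> belongs to is recovered as \<open>\<Union>p\<close>.\<close>

definition route_point ::
  "'v::finite set set \<Rightarrow> 'k::finite set set \<Rightarrow> ('k set \<Rightarrow> 'v \<times> 'v \<Rightarrow> real) \<Rightarrow>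
    ('k set \<Rightarrow> 'v) \<Rightarrow> ('k set \<Rightarrow> 'v) \<Rightarrow> ('v, 'k) point" where
  "route_point E l g en ex =
    (\<chi> n. if fst n \<in> arcs E \<and> snd n \<in> l then g (snd n) (fst n) else 0,
     \<chi> n. of_bool (snd n \<in> partitions l \<and> fst n = ex (\<Union>(snd n))),
     \<chi> n. of_bool (snd n \<in> l \<and> fst n = en (snd n)),
     \<chi> n. of_bool (snd n \<in> l \<and> fst n = ex (snd n)))"

lemma route_point_entries:
  assumes "route_point E l g en ex = (f, w, yhat, ybar)"
  shows "f $ (a, s) = (if a \<in> arcs E \<and> s \<in> l then g s a else 0)"
    and "w $ (i, p) = of_bool (p \<in> partitions l \<and> i = ex (\<Union>p))"
    and "yhat $ (i, s) = of_bool (s \<in> l \<and> i = en s)"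
    and "ybar $ (i, s) = of_bool (s \<in> l \<and> i = ex s)"
  using assms by (auto simp: route_point_def)

lemma net_outflow_arcs:
  fixes E :: "'v::finite set set"
  shows "net_outflow (arcs E) fst snd f i = sum f (out_arcs E i) - sum f (in_arcs E i)"
  by (simp add: net_outflow_eq out_arcs_def in_arcs_def)

lemma arcs_subset: "simple_graph V E \<Longrightarrow> arcs E \<subseteq> V \<times> V"
  by (fastforce simp: simple_graph_def arcs_def)

lemma route_point_in_Q_IP:
  fixes V :: "'v::finite set" and l :: "'k::finite set set"
  assumes l: "l \<in> laminar_families K"
    and V: "\<And>s. s \<in> l \<Longrightarrow> en s \<in> V" "\<And>s. s \<in> l \<Longrightarrow> ex s \<in> V"
    and g: "\<And>s a. s \<in> l \<Longrightarrow> a \<in> arcs E \<Longrightarrow> g s a \<in> {0, 1}"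
    and flow: "\<And>s i. s \<in> l \<Longrightarrow> i \<in> V \<Longrightarrow>
      net_outflow (arcs E) fst snd (g s) i = of_bool (i = en s) - of_bool (i = ex s)"
    and root: "en K = r" and leaf: "\<And>k. k \<in> K \<Longrightarrow> ex {k} = t k"
    and link: "\<And>s c. s \<in> l \<Longrightarrow> c \<in> child_sets l s \<Longrightarrow> en c = ex s"
  shows "route_point E l g en ex \<in> Q_IP V E r K t l"
proof -
  obtain f w yhat ybar where y: "route_point E l g en ex = (f, w, yhat, ybar)"
    by (cases "route_point E l g en ex") auto
  note entries = route_point_entries[OF y]
  have U: "\<Union>p \<in> l" "\<And>c. c \<in> p \<Longrightarrow> c \<in> l \<and> en c = ex (\<Union>p)" if "p \<in> partitions l" for p
  proof -
    obtain s where s: "s \<in> l" "2 \<le> card s" "p = child_sets l s"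
      using \<open>p \<in> partitions l\<close> by (auto simp: partitions_def)
    then have "\<Union>p = s" using Union_child_sets[OF l] by auto
    then show "\<Union>p \<in> l" "\<And>c. c \<in> p \<Longrightarrow> c \<in> l \<and> en c = ex (\<Union>p)"
      using s link child_setsD by auto
  qed
  have Kl: "K \<in> l" "\<And>k. k \<in> K \<Longrightarrow> {k} \<in> l" using l by (auto simp: laminar_families_def)
  have point: "is_point V E l (f, w, yhat, ybar)"
    using V U by (auto simp: is_point_def supported_on_def entries)
  have binary: "entries_in {0, 1} V E l (f, w, yhat, ybar)"
    using g by (auto simp: entries_in_def entries)
  have "(\<Sum>a\<in>out_arcs E i. f $ (a, s)) - (\<Sum>a\<in>in_arcs E i. f $ (a, s)) = yhat $ (i, s) - ybar $ (i, s)"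
    if "i \<in> V" "s \<in> l" for i s
  proof -
    have "(\<Sum>a\<in>out_arcs E i. f $ (a, s)) = sum (g s) (out_arcs E i)"
      "(\<Sum>a\<in>in_arcs E i. f $ (a, s)) = sum (g s) (in_arcs E i)"
      using that by (auto simp: out_arcs_def in_arcs_def entries intro!: sum.cong)
    then show ?thesis using flow[OF that(2,1)] that by (simp add: net_outflow_arcs entries)
  qed
  moreover have "w $ (i, child_sets l s) = ybar $ (i, s)" if "s \<in> l" "2 \<le> card s" for i s
    using that Union_child_sets[OF l that] by (auto simp: partitions_def entries)
  moreover have "w $ (i, p) = yhat $ (i, c)" if "p \<in> partitions l" "c \<in> p" for i p c
    using that U by (auto simp: entries)
  moreover have "(\<Sum>i\<in>V. w $ (i, p)) = 1" if "p \<in> partitions l" for p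
    using V(2)[OF U(1)[OF that]] that by (simp add: entries of_bool_def)
  moreover have "yhat $ (i, K) = 0" if "i \<noteq> r" for i
    using that root Kl by (auto simp: entries)
  moreover have "ybar $ (t k, {k}) = 1" "i \<noteq> t k \<Longrightarrow> ybar $ (i, {k}) = 0" if "k \<in> K" for i k
    using that leaf Kl by (auto simp: entries)
  moreover have "yhat $ (r, K) = 1" using root Kl by (auto simp: entries)
  ultimately have "linear_constraints V E r K t l (f, w, yhat, ybar)"
    unfolding linear_constraints_def by auto
  then show ?thesis unfolding y using point binary by (simp add: Q_IP_def)
qed

lemma linear_constraintsD:
  assumes "linear_constraints V E r K t l (f, w, yhat, ybar)"
  shows "i \<in> V \<Longrightarrow> s \<in> l \<Longrightarrow>
      sum (\<lambda>a. f $ (a, s)) (out_arcs E i) - sum (\<lambda>a. f $ (a, s)) (in_arcs E i) =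
      yhat $ (i, s) - ybar $ (i, s)"
    and "i \<in> V \<Longrightarrow> s \<in> l \<Longrightarrow> 2 \<le> card s \<Longrightarrow> w $ (i, child_sets l s) = ybar $ (i, s)"
    and "i \<in> V \<Longrightarrow> p \<in> partitions l \<Longrightarrow> s \<in> p \<Longrightarrow> w $ (i, p) = yhat $ (i, s)"
    and "p \<in> partitions l \<Longrightarrow> (\<Sum>i\<in>V. w $ (i, p)) = 1"
    and "yhat $ (r, K) = 1" and "i \<in> V - {r} \<Longrightarrow> yhat $ (i, K) = 0"
    and "k \<in> K \<Longrightarrow> ybar $ (t k, {k}) = 1"
    and "k \<in> K \<Longrightarrow> i \<in> V - {t k} \<Longrightarrow> ybar $ (i, {k}) = 0"
  using assms unfolding linear_constraints_def prod.case by blast+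

section \<open>Rounding a point of the relaxation\<close>

definition keeps_integral_entries :: "real ^ 'n \<Rightarrow> real ^ 'n \<Rightarrow> bool" where
  "keeps_integral_entries x y \<longleftrightarrow> (\<forall>n. x $ n \<in> {0, 1} \<longrightarrow> y $ n = x $ n)"

lemma keeps_integral_entriesI:
  assumes "\<And>i j. x $ (i, j) \<in> {0, 1} \<Longrightarrow> y $ (i, j) = x $ (i, j)"
  shows "keeps_integral_entries x y"
  unfolding keeps_integral_entries_def using assms by (metis surj_pair)

text \<open>Each layer carries exactly one unit: \<open>w\<close> is normalised on every partition, and the remaining
cases, the entry of \<open>K\<close> and the exits of singletons, are prescribed point masses.\<close>

lemma Q_LP_layer_sums:
  fixes V :: "'v::finite set" and l :: "'k::finite set set"
  assumes l: "l \<in> laminar_families K" and V: "r \<in> V" "t ` K \<subseteq> V"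
    and lin: "linear_constraints V E r K t l (f, w, yhat, ybar)" and s: "s \<in> l"
  shows "(\<Sum>i\<in>V. yhat $ (i, s)) = 1" "(\<Sum>i\<in>V. ybar $ (i, s)) = 1"
proof -
  have unit: "sum h V = 1" if "h j = 1" "j \<in> V" "\<And>i. i \<in> V - {j} \<Longrightarrow> h i = 0"
    for h :: "'v \<Rightarrow> real" and j
    using that by (simp add: sum.remove)
  have wsum: "(\<Sum>i\<in>V. w $ (i, child_sets l u)) = 1" if "u \<in> l" "2 \<le> card u" for u
    using that lin by (auto simp: linear_constraints_def partitions_def)
  show "(\<Sum>i\<in>V. yhat $ (i, s)) = 1"
  proof (cases "s = K")
    case True
    then show ?thesis using lin V by (intro unit[of _ r]) (auto simp: linear_constraints_def)
  next
    case False
    then obtain u where u: "u \<in> l" "s \<in> child_sets l u" using parent_exists[OF l s] by metis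
    then have c: "2 \<le> card u" using two_le_card_parent[OF l] by auto
    then have "yhat $ (i, s) = w $ (i, child_sets l u)" if "i \<in> V" for i
      using lin u that by (fastforce simp: linear_constraints_def partitions_def)
    then show ?thesis using wsum[OF u(1) c] by simp
  qed
  show "(\<Sum>i\<in>V. ybar $ (i, s)) = 1"
  proof (cases "2 \<le> card s")
    case True
    then have "ybar $ (i, s) = w $ (i, child_sets l s)" if "i \<in> V" for i
      using lin s that by (simp add: linear_constraints_def)
    then show ?thesis using wsum[OF s True] by simp
  next
    case False
    then obtain k where "k \<in> K" "s = {k}" using card_le_1_member_laminar[OF l s] by metis
    then show ?thesis using lin V by (intro unit[of _ "t k"]) (auto simp: linear_constraints_def)
  qed
qed

text \<open>The layers are rounded from the root downwards, the exit chosen in a layer being the entry of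
its children. Positive probability of all chosen nodes ensures that entries of \<open>yhat\<close>,
\<open>ybar\<close> and \<open>w\<close> equal to 0 or 1 survive, and that the exit of a singleton \<open>{k}\<close>
is the terminal \<open>t k\<close>.\<close>

lemma Q_LP_rounding:
  fixes V :: "'v::finite set" and l :: "'k::finite set set"
  assumes A: "arcs E \<subseteq> V \<times> V" and l: "l \<in> laminar_families K"
    and V: "r \<in> V" "t ` K \<subseteq> V"
    and x: "(f, w, yhat, ybar) \<in> Q_LP V E r K t l"
  obtains f' w' yhat' ybar' where "(f', w', yhat', ybar') \<in> Q_IP V E r K t l"
    "keeps_integral_entries f f'" "keeps_integral_entries w w'"
    "keeps_integral_entries yhat yhat'" "keeps_integral_entries ybar ybar'"
proof -
  have pt: "is_point V E l (f, w, yhat, ybar)"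
    and lin: "linear_constraints V E r K t l (f, w, yhat, ybar)"
    and ent: "entries_in {0..1} V E l (f, w, yhat, ybar)"
    using x by (auto simp: Q_LP_def)
  note sums = Q_LP_layer_sums[OF l V lin]
  have box: "\<And>a s. s \<in> l \<Longrightarrow> a \<in> arcs E \<Longrightarrow> f $ (a, s) \<in> {0..1}"
    "\<And>i s. s \<in> l \<Longrightarrow> i \<in> V \<Longrightarrow> yhat $ (i, s) \<in> {0..1}"
    "\<And>i s. s \<in> l \<Longrightarrow> i \<in> V \<Longrightarrow> ybar $ (i, s) \<in> {0..1}"
    using ent by (auto simp: entries_in_def)
  have Kl: "K \<in> l" "\<And>k. k \<in> K \<Longrightarrow> {k} \<in> l" using l by (auto simp: laminar_families_def)
  have lin_w: "\<And>i s. i \<in> V \<Longrightarrow> s \<in> l \<Longrightarrow> 2 \<le> card s \<Longrightarrow> w $ (i, child_sets l s) = ybar $ (i, s)"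
    "\<And>i p c. i \<in> V \<Longrightarrow> p \<in> partitions l \<Longrightarrow> c \<in> p \<Longrightarrow> w $ (i, p) = yhat $ (i, c)"
    using lin unfolding linear_constraints_def prod.case by blast+
  \<comment> \<open>A child is entered with the same distribution with which its parent is left.\<close>
  have shared: "yhat $ (i, c) = ybar $ (i, s)" if "s \<in> l" "c \<in> child_sets l s" "i \<in> V" for i s c
  proof -
    have card: "2 \<le> card s" using two_le_card_parent[OF l that(2)] .
    then have "child_sets l s \<in> partitions l" using that by (auto simp: partitions_def)
    then show ?thesis using lin_w(1)[OF that(3,1) card] lin_w(2)[OF that(3) _ that(2)] by simp
  qed
  define P where "P s i \<longleftrightarrow> i \<in> V \<and> yhat $ (i, s) > 0" for s i
  define Q where "Q s i j g \<longleftrightarrow> j \<in> V \<and> ybar $ (j, s) > 0 \<and> (\<forall>a\<in>arcs E. g a \<in> {0, 1}) \<and>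
    (\<forall>a\<in>arcs E. f $ (a, s) \<in> {0, 1} \<longrightarrow> g a = f $ (a, s)) \<and>
    (\<forall>v\<in>V. net_outflow (arcs E) fst snd g v = of_bool (v = i) - of_bool (v = j))"
    for s i j and g :: "'v \<times> 'v \<Rightarrow> real"
  have root: "P K r" using lin V by (simp add: P_def linear_constraints_def)
  have step: "\<exists>j g. Q s i j g \<and> (\<forall>c\<in>child_sets l s. P c j)" if s: "s \<in> l" and P: "P s i" for s i
  proof -
    have "net_outflow (arcs E) fst snd (\<lambda>a. f $ (a, s)) v = yhat $ (v, s) - ybar $ (v, s)"
      if "v \<in> V" for v
      using lin s that by (simp add: net_outflow_arcs linear_constraints_def)
    note flow = this
    have "\<exists>j g. Q s i j g" unfolding Q_def
    proof (rule layer_rounding[where f = "\<lambda>a. f $ (a, s)" and x = "\<lambda>v. yhat $ (v, s)"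
          and z = "\<lambda>v. ybar $ (v, s)"])
      show "finite V" "arcs E \<subseteq> V \<times> V" "i \<in> V" "yhat $ (i, s) > 0"
        using A P by (auto simp: P_def)
    qed (assumption | rule box[OF s] sums[OF s] flow)+
    then obtain j g where jg: "Q s i j g" by blast
    then have "\<forall>c\<in>child_sets l s. P c j" using shared[OF s] by (auto simp: Q_def P_def)
    then show ?thesis using jg by blast
  qed
  have "\<exists>en ex g. en K = r \<and> (\<forall>s\<in>l. P s (en s) \<and> Q s (en s) (ex s) (g s) \<and>
      (\<forall>c\<in>child_sets l s. en c = ex s))"
    by (rule top_down_choice[where P = P and Q = Q, OF l root]) (rule step)
  then obtain en ex g where en: "en K = r" and P: "\<And>s. s \<in> l \<Longrightarrow> P s (en s)"
    and Q: "\<And>s. s \<in> l \<Longrightarrow> Q s (en s) (ex s) (g s)"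
    and link: "\<And>s c. s \<in> l \<Longrightarrow> c \<in> child_sets l s \<Longrightarrow> en c = ex s"
    by blast
  have yhat_ind: "yhat $ (i, s) = of_bool (i = en s)"
    if "s \<in> l" "i \<in> V" "yhat $ (i, s) \<in> {0, 1}" for s i
    using unit_sum_01_eq_indicator[of V "\<lambda>v. yhat $ (v, s)" "en s" i] that P box(2) sums(1)
    by (auto simp: P_def)
  have ybar_ind: "ybar $ (i, s) = of_bool (i = ex s)"
    if "s \<in> l" "i \<in> V" "ybar $ (i, s) \<in> {0, 1}" for s i
    using unit_sum_01_eq_indicator[of V "\<lambda>v. ybar $ (v, s)" "ex s" i] that Q box(3) sums(2)
    by (auto simp: Q_def)
  have leaf: "ex {k} = t k" if "k \<in> K" for k
    using ybar_ind[of "{k}" "t k"] lin V(2) Kl(2) that by (auto simp: linear_constraints_def)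
  have w_ind: "w $ (i, p) = of_bool (i = ex (\<Union>p))"
    if p: "p \<in> partitions l" and "i \<in> V" "w $ (i, p) \<in> {0, 1}" for p i
  proof -
    obtain s where s: "s \<in> l" "2 \<le> card s" "p = child_sets l s"
      using p by (auto simp: partitions_def)
    then have "w $ (i, p) = ybar $ (i, s)" "\<Union>p = s"
      using lin_w(1)[OF that(2) s(1,2)] Union_child_sets[OF l s(1,2)] by simp_all
    then show ?thesis using ybar_ind[OF s(1) that(2)] that(3) by simp
  qed
  have outside: "\<And>a s. \<not> (a \<in> arcs E \<and> s \<in> l) \<Longrightarrow> f $ (a, s) = 0"
    "\<And>i p. \<not> (i \<in> V \<and> p \<in> partitions l) \<Longrightarrow> w $ (i, p) = 0"
    "\<And>i s. \<not> (i \<in> V \<and> s \<in> l) \<Longrightarrow> yhat $ (i, s) = 0"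
    "\<And>i s. \<not> (i \<in> V \<and> s \<in> l) \<Longrightarrow> ybar $ (i, s) = 0"
    using pt by (auto simp: is_point_def supported_on_def)
  have IP: "route_point E l g en ex \<in> Q_IP V E r K t l"
    using P Q by (intro route_point_in_Q_IP[OF l] en leaf link) (auto simp: P_def Q_def)
  then have supp: "is_point V E l (route_point E l g en ex)" by (auto simp: Q_IP_def)
  obtain f' w' yhat' ybar' where y: "route_point E l g en ex = (f', w', yhat', ybar')"
    by (cases "route_point E l g en ex") auto
  note y' = route_point_entries[OF y]
  have outside': "\<And>i p. \<not> (i \<in> V \<and> p \<in> partitions l) \<Longrightarrow> w' $ (i, p) = 0"
    "\<And>i s. \<not> (i \<in> V \<and> s \<in> l) \<Longrightarrow> yhat' $ (i, s) = 0"
    "\<And>i s. \<not> (i \<in> V \<and> s \<in> l) \<Longrightarrow> ybar' $ (i, s) = 0"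
    using supp unfolding y by (auto simp: is_point_def supported_on_def)
  have "keeps_integral_entries f f'"
  proof (rule keeps_integral_entriesI)
    fix a s assume "f $ (a, s) \<in> {0, 1}"
    then show "f' $ (a, s) = f $ (a, s)"
      using Q[of s] outside(1)[of a s] unfolding y' Q_def by presburger
  qed
  moreover have "keeps_integral_entries w w'"
  proof (rule keeps_integral_entriesI)
    fix i p assume "w $ (i, p) \<in> {0, 1}"
    then show "w' $ (i, p) = w $ (i, p)"
      using w_ind[of p i] outside(2)[of i p] outside'(1)[of i p]
      by (cases "i \<in> V \<and> p \<in> partitions l") (simp_all add: y')
  qed
  moreover have "keeps_integral_entries yhat yhat'"
  proof (rule keeps_integral_entriesI)
    fix i s assume "yhat $ (i, s) \<in> {0, 1}"
    then show "yhat' $ (i, s) = yhat $ (i, s)"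
      using yhat_ind[of s i] outside(3)[of i s] outside'(2)[of i s]
      by (cases "i \<in> V \<and> s \<in> l") (simp_all add: y')
  qed
  moreover have "keeps_integral_entries ybar ybar'"
  proof (rule keeps_integral_entriesI)
    fix i s assume "ybar $ (i, s) \<in> {0, 1}"
    then show "ybar' $ (i, s) = ybar $ (i, s)"
      using ybar_ind[of s i] outside(4)[of i s] outside'(3)[of i s]
      by (cases "i \<in> V \<and> s \<in> l") (simp_all add: y')
  qed
  ultimately show ?thesis using that IP unfolding y by blast
qed

section \<open>The relaxation is a compact convex set\<close>

text \<open>Besides convexity (\<open>u, v \<ge> 0\<close>), this yields points extrapolated beyond the end of a
segment (\<open>v < 0\<close>).\<close>

lemma linear_constraints_affine:
  fixes x y :: "('v::finite, 'k::finite) point"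
  assumes "linear_constraints V E r K t l x" "linear_constraints V E r K t l y" "u + v = 1"
  shows "linear_constraints V E r K t l (u *\<^sub>R x + v *\<^sub>R y)"
proof -
  obtain f w yh yb where x: "x = (f, w, yh, yb)" by (cases x) auto
  obtain f' w' yh' yb' where y: "y = (f', w', yh', yb')" by (cases y) auto
  note X = linear_constraintsD[OF assms(1)[unfolded x]]
  note Y = linear_constraintsD[OF assms(2)[unfolded y]]
  have flow: "(\<Sum>a\<in>out_arcs E i. u * f $ (a, s) + v * f' $ (a, s)) -
      (\<Sum>a\<in>in_arcs E i. u * f $ (a, s) + v * f' $ (a, s)) =
      (u * yh $ (i, s) + v * yh' $ (i, s)) - (u * yb $ (i, s) + v * yb' $ (i, s))"
    if "i \<in> V" "s \<in> l" for i s
  proof -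
    have "u * (sum (\<lambda>a. f $ (a, s)) (out_arcs E i) - sum (\<lambda>a. f $ (a, s)) (in_arcs E i)) +
      v * (sum (\<lambda>a. f' $ (a, s)) (out_arcs E i) - sum (\<lambda>a. f' $ (a, s)) (in_arcs E i)) =
      u * (yh $ (i, s) - yb $ (i, s)) + v * (yh' $ (i, s) - yb' $ (i, s))"
      by (simp only: X(1)[OF that] Y(1)[OF that])
    then show ?thesis
      by (simp add: sum.distrib right_diff_distrib flip: sum_distrib_left)
  qed
  have total: "(\<Sum>i\<in>V. u * w $ (i, p) + v * w' $ (i, p)) = 1" if "p \<in> partitions l" for p
    using X(4)[OF that] Y(4)[OF that] assms(3) by (simp add: sum.distrib flip: sum_distrib_left)
  have comb: "u *\<^sub>R x + v *\<^sub>R y =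
      (u *\<^sub>R f + v *\<^sub>R f', u *\<^sub>R w + v *\<^sub>R w', u *\<^sub>R yh + v *\<^sub>R yh', u *\<^sub>R yb + v *\<^sub>R yb')"
    by (simp add: x y)
  show ?thesis
    unfolding comb linear_constraints_def prod.case
      vector_add_component vector_scaleR_component real_scaleR_def
  proof (intro conjI ballI impI)
    show "u * yh $ (r, K) + v * yh' $ (r, K) = 1" using assms(3) by (simp add: X(5) Y(5))
    show "u * yb $ (t k, {k}) + v * yb' $ (t k, {k}) = 1" if "k \<in> K" for k
      using assms(3) by (simp add: X(7)[OF that] Y(7)[OF that])
  qed (simp_all only: flow total X(2,3,6,8) Y(2,3,6,8) mult_zero_right add_0_right)
qed

lemma is_point_linear:
  assumes "is_point V E l x" "is_point V E l y"
  shows "is_point V E l (u *\<^sub>R x + v *\<^sub>R y)"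
  using assms by (cases x; cases y) (auto simp: is_point_def supported_on_def)

lemma entries_in_convex:
  assumes "entries_in {0..1} V E l x" "entries_in {0..1} V E l y" "0 \<le> u" "0 \<le> v" "u + v = 1"
  shows "entries_in {0..1} V E l (u *\<^sub>R x + v *\<^sub>R y)"
proof -
  have "u * p + v * q \<in> {0..1}" if "p \<in> {0..1}" "q \<in> {0..1}" for p q
    using convexD[OF convex_closed_interval[of 0 "1 :: real"], of p q u v] that assms by simp
  then show ?thesis using assms(1,2)
    by (cases x; cases y) (auto simp: entries_in_def)
qed

lemma entries_in_mono: "entries_in X V E l x \<Longrightarrow> X \<subseteq> Y \<Longrightarrow> entries_in Y V E l x"
  by (cases x) (auto simp: entries_in_def subset_iff)

lemma Q_IP_subset_Q_LP: "Q_IP V E r K t l \<subseteq> Q_LP V E r K t l"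
  by (auto simp: Q_IP_def Q_LP_def intro: entries_in_mono)

lemma convex_Q_LP: "convex (Q_LP V E r K t l)"
  unfolding Q_LP_def
  by (rule convexI)
    (simp only: Q_LP_def mem_Collect_eq linear_constraints_affine is_point_linear entries_in_convex)

lemma closed_Collect_Ball:
  assumes "\<And>i. i \<in> I \<Longrightarrow> closed {x. P x i}"
  shows "closed {x. \<forall>i\<in>I. P x i}"
proof -
  have "{x. \<forall>i\<in>I. P x i} = (\<Inter>i\<in>I. {x. P x i})" by auto
  then show ?thesis using assms by auto
qed

lemma closed_Collect_constant_imp:
  assumes "C \<Longrightarrow> closed {x. P x}"
  shows "closed {x. C \<longrightarrow> P x}"
  using assms by (cases C) auto

lemma closed_Q_LP: "closed (Q_LP V E r K t l)"
proof -
  have "closed {x. is_point V E l x}"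
    unfolding is_point_def supported_on_def case_prod_beta
    by (intro closed_Collect_conj closed_Collect_all closed_Collect_constant_imp
        closed_Collect_eq continuous_intros)
  moreover have "closed {x. linear_constraints V E r K t l x}"
    unfolding linear_constraints_def case_prod_beta
    by (intro closed_Collect_conj closed_Collect_Ball closed_Collect_constant_imp
        closed_Collect_eq continuous_intros)
  moreover have "closed {x. entries_in {0..1} V E l x}"
    unfolding entries_in_def case_prod_beta atLeastAtMost_iff
    by (intro closed_Collect_conj closed_Collect_Ball closed_Collect_le continuous_intros)
  ultimately show ?thesis
    unfolding Q_LP_def by (intro closed_Collect_conj)
qed

lemma supported_on_unit_interval:
  assumes "supported_on x I" "\<And>n. n \<in> I \<Longrightarrow> x $ n \<in> {0..1}"
  shows "x $ n \<in> {0..1}"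
  using assms by (cases "n \<in> I") (auto simp: supported_on_def)

lemma Q_LP_entries_in_unit_interval:
  assumes "(f, w, yhat, ybar) \<in> Q_LP V E r K t l"
  shows "f $ a \<in> {0..1}" "w $ b \<in> {0..1}" "yhat $ c \<in> {0..1}" "ybar $ c \<in> {0..1}"
proof -
  have point: "is_point V E l (f, w, yhat, ybar)"
    and entries: "entries_in {0..1} V E l (f, w, yhat, ybar)"
    using assms by (auto simp: Q_LP_def)
  show "f $ a \<in> {0..1}" by (rule supported_on_unit_interval[where I = "arcs E \<times> l"]) (use point entries in \<open>auto simp: is_point_def entries_in_def\<close>)
  show "w $ b \<in> {0..1}" by (rule supported_on_unit_interval[where I = "V \<times> partitions l"]) (use point entries in \<open>auto simp: is_point_def entries_in_def\<close>)
  show "yhat $ c \<in> {0..1}" by (rule supported_on_unit_interval[where I = "V \<times> l"]) (use point entries in \<open>auto simp: is_point_def entries_in_def\<close>)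
  show "ybar $ c \<in> {0..1}" by (rule supported_on_unit_interval[where I = "V \<times> l"]) (use point entries in \<open>auto simp: is_point_def entries_in_def\<close>)
qed

lemma compact_Q_LP: "compact (Q_LP V E r K t l)"
proof -
  have "Q_LP V E r K t l \<subseteq> cbox 0 1 \<times> cbox 0 1 \<times> cbox 0 1 \<times> cbox 0 1"
    using Q_LP_entries_in_unit_interval[of _ _ _ _ V E r K t l] by (auto simp: mem_box_cart)
  then have "bounded (Q_LP V E r K t l)"
    by (rule bounded_subset[rotated]) (intro bounded_Times bounded_cbox)
  then show ?thesis using closed_Q_LP by (simp add: compact_eq_bounded_closed)
qed

section \<open>Extreme points of the relaxation\<close>

lemma eventually_extrapolation_in_cube:
  fixes x y :: "real ^ 'n::finite"
  assumes "\<And>n. x $ n \<in> {0..1}" "keeps_integral_entries x y"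
  shows "\<forall>\<^sub>F \<epsilon> in at_right 0. \<forall>n. (1 + \<epsilon>) * x $ n + (- \<epsilon>) * y $ n \<in> {0..1}"
proof (rule eventually_all_finite)
  fix n
  show "\<forall>\<^sub>F \<epsilon> in at_right 0. (1 + \<epsilon>) * x $ n + (- \<epsilon>) * y $ n \<in> {0..1}"
  proof (cases "x $ n \<in> {0, 1}")
    case True
    then have "y $ n = x $ n" using assms(2) unfolding keeps_integral_entries_def by blast
    then show ?thesis using assms(1)[of n] by (simp add: algebra_simps)
  next
    case False
    then have "0 < x $ n" "x $ n < 1" using assms(1)[of n] by auto
    moreover have "((\<lambda>\<epsilon>. (1 + \<epsilon>) * x $ n + (- \<epsilon>) * y $ n) \<longlongrightarrow> (1 + 0) * x $ n + (- 0) * y $ n) (at_right 0)"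
      by (intro tendsto_intros)
    ultimately have "\<forall>\<^sub>F \<epsilon> in at_right 0. 0 < (1 + \<epsilon>) * x $ n + (- \<epsilon>) * y $ n"
      "\<forall>\<^sub>F \<epsilon> in at_right 0. (1 + \<epsilon>) * x $ n + (- \<epsilon>) * y $ n < 1"
      by (auto dest: order_tendstoD)
    then show ?thesis by eventually_elim auto
  qed
qed

lemma extreme_point_not_extrapolated:
  assumes "x extreme_point_of S" "y \<in> S" "(1 + \<epsilon>) *\<^sub>R x + (- \<epsilon>) *\<^sub>R y \<in> S" "\<epsilon> > 0"
  shows "x = y"
proof (rule ccontr)
  assume ne: "x \<noteq> y"
  define z where "z = (1 + \<epsilon>) *\<^sub>R x + (- \<epsilon>) *\<^sub>R y"
  \<comment> \<open>This weight solves \<open>x = (1 - u) y + u z\<close>.\<close>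
  define u where "u = 1 / (1 + \<epsilon>)"
  have u: "0 < u" "u < 1" "u * (1 + \<epsilon>) = 1" using assms(4) by (auto simp: u_def)
  have ue: "u * \<epsilon> = 1 - u" using u(3) by (simp add: algebra_simps)
  have "(1 - u) *\<^sub>R y + u *\<^sub>R z = (1 - u) *\<^sub>R y + (u * (1 + \<epsilon>)) *\<^sub>R x - (u * \<epsilon>) *\<^sub>R y"
    by (simp add: z_def scaleR_add_right scaleR_diff_right)
  also have "\<dots> = x" unfolding u(3) ue by simp
  finally have "x = (1 - u) *\<^sub>R y + u *\<^sub>R z" by simp
  moreover have "y \<noteq> z"
  proof
    assume "y = z"
    then have "x = y" using calculation by (simp add: algebra_simps)
    then show False using ne by simp
  qed
  ultimately have "x \<in> open_segment y z" using u by (auto simp: in_segment)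
  then show False using assms z_def by (auto simp: extreme_point_of_def)
qed

text \<open>Moving from \<open>x\<close> away from its rounding \<open>y\<close> by a small step stays inside the relaxation, so \<open>x\<close> would
be interior to a segment unless \<open>x = y\<close>.\<close>

lemma extreme_point_of_Q_LP_integral:
  fixes V :: "'v::finite set" and l :: "'k::finite set set"
  assumes "arcs E \<subseteq> V \<times> V" "l \<in> laminar_families K" "r \<in> V" "t ` K \<subseteq> V"
    and extreme: "x extreme_point_of Q_LP V E r K t l"
  shows "x \<in> Q_IP V E r K t l"
proof -
  obtain f w yh yb where x: "x = (f, w, yh, yb)" by (cases x) auto
  have LP: "(f, w, yh, yb) \<in> Q_LP V E r K t l"
    using extreme by (simp add: extreme_point_of_def x)
  obtain f' w' yh' yb' where IP: "(f', w', yh', yb') \<in> Q_IP V E r K t l"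
    and keep: "keeps_integral_entries f f'" "keeps_integral_entries w w'"
      "keeps_integral_entries yh yh'" "keeps_integral_entries yb yb'"
    using Q_LP_rounding[OF assms(1-4) LP] by metis
  define y where "y = (f', w', yh', yb')"
  have y_LP: "y \<in> Q_LP V E r K t l"
    unfolding y_def by (rule subsetD[OF Q_IP_subset_Q_LP IP])
  note unit = Q_LP_entries_in_unit_interval[OF LP]
  have "\<forall>\<^sub>F \<epsilon> in at_right 0. entries_in {0..1} V E l ((1 + \<epsilon>) *\<^sub>R x + (- \<epsilon>) *\<^sub>R y)"
    using eventually_extrapolation_in_cube[OF unit(1) keep(1)]
      eventually_extrapolation_in_cube[OF unit(2) keep(2)]
      eventually_extrapolation_in_cube[OF unit(3) keep(3)]
      eventually_extrapolation_in_cube[OF unit(4) keep(4)]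
    by eventually_elim (simp add: x y_def entries_in_def del: split_paired_All)
  moreover have "\<forall>\<^sub>F \<epsilon> in at_right (0 :: real). \<epsilon> > 0" by (rule eventually_at_right_less)
  ultimately have "\<forall>\<^sub>F \<epsilon> in at_right 0.
      entries_in {0..1} V E l ((1 + \<epsilon>) *\<^sub>R x + (- \<epsilon>) *\<^sub>R y) \<and> \<epsilon> > 0"
    by (rule eventually_conj)
  then obtain \<epsilon> where \<epsilon>: "entries_in {0..1} V E l ((1 + \<epsilon>) *\<^sub>R x + (- \<epsilon>) *\<^sub>R y)" "\<epsilon> > 0"
    using eventually_happens'[of "at_right (0 :: real)"] by (auto simp: trivial_limit_at_right_real)
  have "(1 + \<epsilon>) *\<^sub>R x + (- \<epsilon>) *\<^sub>R y \<in> Q_LP V E r K t l"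
    using LP y_LP \<epsilon>(1) linear_constraints_affine[of V E r K t l x y "1 + \<epsilon>" "- \<epsilon>"]
      is_point_linear[of V E l x y "1 + \<epsilon>" "- \<epsilon>"]
    by (auto simp: Q_LP_def x)
  then have "x = y" using extreme_point_not_extrapolated[OF extreme y_LP] \<epsilon>(2) by blast
  then show ?thesis using IP y_def by simp
qed

section \<open>Integrality\<close>

theorem theorem1:
  fixes V R :: "'v::finite set" and E :: "'v set set" and r :: 'v
    and K :: "'k::finite set" and t :: "'k \<Rightarrow> 'v" and l :: "'k set set"
  assumes "simple_graph V E"
    and "R \<subseteq> V" and "card R \<ge> 2" and "r \<in> R"
    and "bij_betw t K (R - {r})"
    and "l \<in> laminar_families K"
  shows "convex hull (Q_IP V E r K t l) = Q_LP V E r K t l"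
proof
  have V: "r \<in> V" "t ` K \<subseteq> V"
    using assms(2,4) bij_betw_imp_surj_on[OF assms(5)] by auto
  show "convex hull (Q_IP V E r K t l) \<subseteq> Q_LP V E r K t l"
    by (intro hull_minimal Q_IP_subset_Q_LP convex_Q_LP)
  have "Q_LP V E r K t l = convex hull {x. x extreme_point_of Q_LP V E r K t l}"
    by (rule Krein_Milman_Minkowski[OF compact_Q_LP convex_Q_LP])
  also have "\<dots> \<subseteq> convex hull (Q_IP V E r K t l)"
    using extreme_point_of_Q_LP_integral[OF arcs_subset[OF assms(1)] assms(6) V]
    by (intro hull_mono) auto
  finally show "Q_LP V E r K t l \<subseteq> convex hull (Q_IP V E r K t l)" .
qed

end
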